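(* Let $\lambda$ be any partition of length $3$ (i.e. $\lambda=(\lambda_1\ge\lambda_2\ge\lambda_3)$ with positive integer parts). Then the $q,t$-Catalan number $C_\lambda(q,t)$ is $q,t$-symmetric, i.e. $C_\lambda(q,t)=C_\lambda(t,q)$ as polynomials in $q,t$.
   Context: For a vector $\vec{k}=(k_1,k_2,k_3)$ of positive integers, a $\vec{k}$-Dyck path is a lattice path starting and ending at level $0$ and never going below level $0$, consisting of three red up steps of heights $k_1,k_2,k_3$ (in this order, the first being the first step of the path) and $k_1+k_2+k_3$ blue down steps of height $1$. The red ranks $(r_1,r_2,r_3)$ of the path are the levels at which the three red steps start, so $r_1=0$. The set $\mathcal{D}_{\vec{k}}$ of $\vec{k}$-Dyck paths is in bijection, via red ranks, with the set of integer pairs $(r_2,r_3)$ such that $0\le r_2\le k_1$ and $0\le r_3\le r_2+k_2$. For $D\in\mathcal{D}_{\vec{k}}$ with red ranks $(0,r_2,r_3)$, the statistics area and bounce are $$\mathrm{area}(D)=r_2+r_3,$$ $$\mathrm{bounce}(D)=\begin{cases}2(k_1-r_2)+r_2+k_2-r_3-\min(r_2,k_2), & \text{if } r_2+k_2-r_3\ge 2\min(r_2,k_2),\\[2pt] 2(k_1-r_2)+\left\lceil \frac{r_2+k_2-r_3}{2}\right\rceil, & \text{otherwise.}\end{cases}$$ Set $$C_{\vec{k}}(q,t)=\sum_{D\in\mathcal{D}_{\vec{k}}}q^{\mathrm{area}(D)}t^{\mathrm{bounce}(D)}.$$ For a vector $\vec{k}$ of positive integers, let $\lambda(\vec{k})$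 be the partition obtained by arranging the entries of $\vec{k}$ in decreasing (weakly) order. For a partition $\lambda$ of length $3$, $$C_\lambda(q,t)=\sum_{\vec{k}:\ \lambda(\vec{k})=\lambda}C_{\vec{k}}(q,t),$$ the sum being over the distinct vectors $\vec{k}\in\mathbb{Z}_{>0}^3$ with $\lambda(\vec{k})=\lambda$. *)

theory Defs
  imports "HOL-Computational_Algebra.Polynomial"
begin

datatype step = Up nat | Down

fun is_up :: "step \<Rightarrow> bool" where
  "is_up (Up h) = True"
| "is_up Down = False"

fun step_height :: "step \<Rightarrow> int" where
  "step_height (Up h) = int h"
| "step_height Down = -1"

definition level :: "step list \<Rightarrow> int" where
  "level w = sum_list (map step_height w)"

text \<open>Up steps are the red steps, down steps the blue ones.  Paths start at level 0, so
  \<open>level (take i w)\<close> is the level reached after \<open>i\<close> steps.\<close>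

definition dyck_paths :: "nat list \<Rightarrow> step list set" where
  "dyck_paths k = {w. w \<noteq> [] \<and> is_up (hd w)
      \<and> filter is_up w = map Up k
      \<and> count_list w Down = sum_list k
      \<and> (\<forall>i\<le>length w. 0 \<le> level (take i w))
      \<and> level w = 0}"

definition red_ranks :: "step list \<Rightarrow> int list" where
  "red_ranks w = map (\<lambda>i. level (take i w)) (filter (\<lambda>i. is_up (w ! i)) [0..<length w])"

text \<open>Lists are indexed from 0: \<open>k ! 0\<close>, \<open>k ! 1\<close> are the first two entries of \<open>k\<close>, and
  \<open>red_ranks D ! 1\<close>, \<open>red_ranks D ! 2\<close> are the second and third red ranks.
  Both statistics are nonnegative on \<open>dyck_paths k\<close> for \<open>k\<close> of length 3, so the conversion to
  \<^typ>\<open>nat\<close> never truncates there.\<close>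

definition area :: "step list \<Rightarrow> nat" where
  "area D = nat (red_ranks D ! 1 + red_ranks D ! 2)"

definition bounce :: "nat list \<Rightarrow> step list \<Rightarrow> nat" where
  "bounce k D =
    (let k1 = int (k ! 0); k2 = int (k ! 1);
         r2 = red_ranks D ! 1; r3 = red_ranks D ! 2
     in nat (if r2 + k2 - r3 \<ge> 2 * min r2 k2
             then 2 * (k1 - r2) + r2 + k2 - r3 - min r2 k2
             else 2 * (k1 - r2) + \<lceil>real_of_int (r2 + k2 - r3) / 2\<rceil>))"

definition qt_catalan_vec :: "nat list \<Rightarrow> 'a::comm_semiring_1 \<Rightarrow> 'a \<Rightarrow> 'a" where
  "qt_catalan_vec k q t = (\<Sum>D\<in>dyck_paths k. q ^ area D * t ^ bounce k D)"

definition is_partition :: "nat list \<Rightarrow> bool" where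
  "is_partition l \<longleftrightarrow> sorted_wrt (\<ge>) l \<and> (\<forall>x\<in>set l. 0 < x)"

definition partition_of :: "nat list \<Rightarrow> nat list" where
  "partition_of k = rev (sort k)"

definition qt_catalan :: "nat list \<Rightarrow> 'a::comm_semiring_1 \<Rightarrow> 'a \<Rightarrow> 'a" where
  "qt_catalan l q t =
    (\<Sum>k\<in>{k. length k = 3 \<and> (\<forall>x\<in>set k. 0 < x) \<and> partition_of k = l}. qt_catalan_vec k q t)"

text \<open>The two indeterminates of the polynomial ring in \<open>q\<close> and \<open>t\<close> over the integers, represented
  as polynomials in \<open>t\<close> whose coefficients are polynomials in \<open>q\<close>.\<close>

definition qvar :: "int poly poly" where
  "qvar = [:[:0, 1:]:]"

definition tvar :: "int poly poly" where
  "tvar = [:0, 1:]"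

end

theory Submission
  imports Defs
begin

text \<open>Already every summand \<open>C_k\<close> is symmetric.  Write \<open>a\<close>, \<open>b\<close> for the first two entries of \<open>k\<close>,
  and encode a path by the pair \<open>(x, s)\<close> with \<open>x = r2\<close> and \<open>s = r2 + b - r3\<close>, the number of blue
  steps between the second and the third red step.  Sort the paths by \<open>d\<close>, where \<open>2 * a + b - d\<close>
  is the total degree \<open>area + bounce\<close>.  For \<open>d < b\<close> and \<open>d \<le> a\<close> the bounces of the paths of degree
  \<open>2 * a + b - d\<close> fill the interval from \<open>d\<close> to \<open>2 * a + b - 2 * d\<close>, each value being taken
  once, and this interval is stable under exchanging area and bounce.  For \<open>d = b\<close> the paths are
  indexed by pairs \<open>(e, p)\<close> with \<open>p \<ge> 0\<close> and \<open>b + 2 * p \<le> e \<le> a + p\<close>, where \<open>e\<close> is the bounce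
  and \<open>2 * a - e\<close> the area; here \<open>(e, p) \<mapsto> (2 * a - e, p + a - e)\<close> is an involution.\<close>

section \<open>Paths with three red steps\<close>

lemma level_simps [simp]:
  "level [] = 0"
  "level (x # w) = step_height x + level w"
  "level (replicate n Down @ w) = level w - int n"
  "level (replicate n Down) = - int n"
  by (simp_all add: level_def sum_list_replicate)

text \<open>The starting height \<open>h\<close> is a parameter so that steps can be peeled off the
  front; Dyck paths have \<open>h = 0\<close>.\<close>

definition stays_nonneg :: "int \<Rightarrow> step list \<Rightarrow> bool" where
  "stays_nonneg h w \<longleftrightarrow> (\<forall>i\<le>length w. 0 \<le> h + level (take i w))"

lemma stays_nonneg_Nil: "stays_nonneg h [] \<longleftrightarrow> 0 \<le> h"
  by (simp add: stays_nonneg_def)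

lemma stays_nonneg_Cons:
  "stays_nonneg h (x # w) \<longleftrightarrow> 0 \<le> h \<and> stays_nonneg (h + step_height x) w"
  unfolding stays_nonneg_def by (simp add: All_less_Suc2 less_Suc_eq_le[symmetric] add.assoc)

lemma stays_nonneg_start: "stays_nonneg h w \<Longrightarrow> 0 \<le> h"
  by (cases w) (simp_all add: stays_nonneg_Nil stays_nonneg_Cons)

text \<open>The level falls along the run, so nonnegativity at its end gives nonnegativity
  throughout.\<close>

lemma stays_nonneg_Downs:
  "stays_nonneg h (replicate n Down @ w) \<longleftrightarrow> stays_nonneg (h - int n) w"
  by (induction n arbitrary: h)
     (auto simp: stays_nonneg_Cons algebra_simps dest: stays_nonneg_start)

lemma red_ranks_Nil: "red_ranks [] = []"
  by (simp add: red_ranks_def)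

lemma red_ranks_Cons:
  "red_ranks (x # w) =
     (if is_up x then [0] else []) @ map ((+) (step_height x)) (red_ranks w)"
  unfolding red_ranks_def
  by (simp add: upt_conv_Cons map_Suc_upt[symmetric] filter_map o_def del: upt_Suc)

lemma red_ranks_Downs:
  "red_ranks (replicate n Down @ w) = map (\<lambda>r. r - int n) (red_ranks w)"
  by (induction n) (simp_all add: red_ranks_Cons o_def algebra_simps)

lemma filter_is_up_eq_ConsD:
  assumes "filter is_up w = u # us"
  obtains n w' where "w = replicate n Down @ u # w'" "filter is_up w' = us"
proof -
  obtain v w' where w: "w = v @ u # w'" "\<forall>x\<in>set v. \<not> is_up x" "us = filter is_up w'"
    using assms by (auto simp: filter_eq_Cons_iff)
  have "x = Down" if "x \<in> set v" for x
    using w(2) that by (cases x) auto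
  then have "v = replicate (length v) Down"
    by (simp add: replicate_length_same)
  with w show thesis
    using that by metis
qed

lemma filter_is_up_eq_NilD:
  assumes "filter is_up w = []"
  obtains n where "w = replicate n Down"
proof -
  have "x = Down" if "x \<in> set w" for x
    using assms that by (cases x) (auto simp: filter_empty_conv)
  then show thesis
    using that[of "length w"] by (simp add: replicate_length_same)
qed

text \<open>The runs of down steps end at the levels \<open>x\<close>,
  \<open>x + int (k ! 1) - s\<close> and 0; on \<open>codes\<close> no run length is truncated by
  \<open>nat\<close>.\<close>

definition path_of :: "nat list \<Rightarrow> int \<times> int \<Rightarrow> step list" where
  "path_of k = (\<lambda>(x, s). Up (k ! 0) # replicate (nat (int (k ! 0) - x)) Down
     @ Up (k ! 1) # replicate (nat s) Down
     @ Up (k ! 2) # replicate (nat (x + int (k ! 1) - s + int (k ! 2))) Down)"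

definition codes :: "int \<Rightarrow> int \<Rightarrow> (int \<times> int) set" where
  "codes a b = {(x, s). 0 \<le> x \<and> x \<le> a \<and> 0 \<le> s \<and> s \<le> x + b}"

lemma red_ranks_path_of:
  assumes "(x, s) \<in> codes (int (k ! 0)) (int (k ! 1))"
  shows "red_ranks (path_of k (x, s)) = [0, x, x + int (k ! 1) - s]"
proof -
  have "red_ranks (replicate n Down) = []" for n
    using red_ranks_Downs[of n "[]"] by (simp add: red_ranks_Nil)
  with assms show ?thesis
    by (simp add: path_of_def codes_def red_ranks_Cons red_ranks_Downs)
qed

lemma path_of_in_dyck_paths:
  assumes "(x, s) \<in> codes (int (k ! 0)) (int (k ! 1))" "length k = 3"
  shows "path_of k (x, s) \<in> dyck_paths k"
proof -
  have k: "k = [k ! 0, k ! 1, k ! 2]"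
    using assms(2) by (auto simp: numeral_3_eq_3 length_Suc_conv)
  have sum: "sum_list k = k ! 0 + k ! 1 + k ! 2"
    by (subst k) simp
  have map: "map Up k = [Up (k ! 0), Up (k ! 1), Up (k ! 2)]"
    by (subst k) simp
  have "stays_nonneg h (replicate n Down) \<longleftrightarrow> int n \<le> h" for h n
    using stays_nonneg_Downs[of h n "[]"] by (simp add: stays_nonneg_Nil)
  then have "stays_nonneg 0 (path_of k (x, s))"
    using assms(1)
    by (simp add: path_of_def codes_def stays_nonneg_Cons stays_nonneg_Downs)
  moreover have "count_list (replicate n Down) Down = n" for n
    by (induction n) auto
  ultimately show ?thesis
    using assms(1)
    by (auto simp: dyck_paths_def stays_nonneg_def map sum path_of_def codes_def)
qed

text \<open>Cutting at the red steps leaves four runs of down steps: the first is empty and the last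
  is forced by the return to level 0.\<close>

lemma dyck_paths_cases:
  assumes "D \<in> dyck_paths k" "length k = 3"
  obtains x s where "(x, s) \<in> codes (int (k ! 0)) (int (k ! 1))" "D = path_of k (x, s)"
proof -
  have "map Up k = [Up (k ! 0), Up (k ! 1), Up (k ! 2)]"
    using assms(2) by (auto simp: numeral_3_eq_3 length_Suc_conv)
  then have D: "filter is_up D = [Up (k ! 0), Up (k ! 1), Up (k ! 2)]"
    "D \<noteq> []" "is_up (hd D)" "stays_nonneg 0 D" "level D = 0"
    using assms(1) by (auto simp: dyck_paths_def stays_nonneg_def)
  obtain n0 D1 where D1: "D = replicate n0 Down @ Up (k ! 0) # D1"
      "filter is_up D1 = [Up (k ! 1), Up (k ! 2)]"
    using D(1) by (rule filter_is_up_eq_ConsD)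
  obtain n1 D2 where D2: "D1 = replicate n1 Down @ Up (k ! 1) # D2"
      "filter is_up D2 = [Up (k ! 2)]"
    using D1(2) by (rule filter_is_up_eq_ConsD)
  obtain n2 D3 where D3: "D2 = replicate n2 Down @ Up (k ! 2) # D3" "filter is_up D3 = []"
    using D2(2) by (rule filter_is_up_eq_ConsD)
  obtain n3 where n3: "D3 = replicate n3 Down"
    using D3(2) by (rule filter_is_up_eq_NilD)
  have n0: "n0 = 0"
    using D(3) D1(1) by (cases n0) auto
  have eq: "D = Up (k ! 0) # replicate n1 Down @ Up (k ! 1) # replicate n2 Down
      @ Up (k ! 2) # replicate n3 Down"
    by (simp add: D1(1) D2(1) D3(1) n3 n0)
  \<comment> \<open>These are the levels at which the second and third red steps start.\<close>
  have le: "int n1 \<le> int (k ! 0)" "int n1 + int n2 \<le> int (k ! 0) + int (k ! 1)"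
    using D(4) unfolding eq
    by (auto simp: stays_nonneg_Cons stays_nonneg_Downs dest: stays_nonneg_start)
  have lev: "int n3 = int (k ! 0) + int (k ! 1) + int (k ! 2) - int n1 - int n2"
    using D(5) unfolding eq by simp
  show thesis
  proof (rule that)
    show "(int (k ! 0) - int n1, int n2) \<in> codes (int (k ! 0)) (int (k ! 1))"
      using le by (simp add: codes_def)
    have "nat (int (k ! 0) - int n1 + int (k ! 1) - int n2 + int (k ! 2)) = n3"
      using lev by linarith
    then show "D = path_of k (int (k ! 0) - int n1, int n2)"
      by (simp add: eq path_of_def)
  qed
qed

section \<open>Symmetry for a fixed vector\<close>

text \<open>Here \<open>(s + 1) div 2\<close> is the ceiling of \<open>s / 2\<close>.\<close>

definition bounce_code :: "int \<Rightarrow> int \<Rightarrow> int \<times> int \<Rightarrow> int" where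
  "bounce_code a b = (\<lambda>(x, s). 2 * (a - x) +
     (if s \<ge> 2 * min x b then s - min x b else (s + 1) div 2))"

lemma qt_catalan_vec_eq_sum_codes:
  fixes q t :: "'a::comm_semiring_1"
  assumes "length k = 3"
  shows "qt_catalan_vec k q t =
    (\<Sum>c\<in>codes (int (k ! 0)) (int (k ! 1)).
      q ^ nat (2 * fst c + int (k ! 1) - snd c) *
      t ^ nat (bounce_code (int (k ! 0)) (int (k ! 1)) c))"
  unfolding qt_catalan_vec_def
proof (rule sum.reindex_bij_witness
    [where i = "path_of k"
       and j = "\<lambda>D. (red_ranks D ! 1, red_ranks D ! 1 + int (k ! 1) - red_ranks D ! 2)"],
    goal_cases)
  case (1 D)
  then show ?case
    using assms by (auto elim!: dyck_paths_cases simp: red_ranks_path_of)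
next
  case (2 D)
  then show ?case
    using assms by (auto elim!: dyck_paths_cases simp: red_ranks_path_of)
next
  case (3 c)
  then show ?case
    by (cases c) (simp add: red_ranks_path_of)
next
  case (4 c)
  then show ?case
    using assms by (cases c) (simp add: path_of_in_dyck_paths)
next
  case (5 D)
  then obtain x s where xs: "(x, s) \<in> codes (int (k ! 0)) (int (k ! 1))" "D = path_of k (x, s)"
    using assms by (elim dyck_paths_cases)
  have ranks: "red_ranks D ! 1 = x" "red_ranks D ! 2 = x + int (k ! 1) - s"
    using xs by (simp_all add: red_ranks_path_of)
  have "\<lceil>real_of_int s / 2\<rceil> = (s + 1) div 2"
    using ceiling_divide_eq_div[of s 2, where ?'a = real] by simp
  moreover have "x + int (k ! 1) - (x + int (k ! 1) - s) = s"
    by simp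
  ultimately have bounce: "bounce k D = nat (bounce_code (int (k ! 0)) (int (k ! 1)) (x, s))"
    unfolding bounce_def Let_def ranks bounce_code_def
    by (simp del: One_nat_def add: algebra_simps)
  then show ?case
    unfolding area_def bounce ranks by (simp del: One_nat_def add: algebra_simps)
qed

text \<open>For \<open>d = b\<close> several paths can share a bounce, and \<open>p = a - x\<close>
  tells them apart; for \<open>d < b\<close> it is a dummy 0. If \<open>d = b\<close>, the bounds on
  \<open>e\<close> express \<open>2 * b \<le> s\<close> and \<open>s \<le> x + b\<close>, and
  together force \<open>b \<le> x\<close>.\<close>

definition sym_codes :: "int \<Rightarrow> int \<Rightarrow> (int \<times> int \<times> int) set" where
  "sym_codes a b = {(d, e, p).
     0 \<le> d \<and> d \<le> a \<and> d < b \<and> d \<le> e \<and> e \<le> 2 * a + b - 2 * d \<and> p = 0 \<or>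
     d = b \<and> 0 \<le> p \<and> b + 2 * p \<le> e \<and> e \<le> a + p}"

text \<open>Area plus bounce is \<open>2 * a + b - min x b\<close> if
  \<open>min x b \<le> s div 2\<close>, and \<open>2 * a + b - s div 2\<close> otherwise; hence the
  minimum.\<close>

definition encode :: "int \<Rightarrow> int \<Rightarrow> int \<times> int \<Rightarrow> int \<times> int \<times> int" where
  "encode a b = (\<lambda>(x, s). let d = min (s div 2) (min x b) in
     (d, bounce_code a b (x, s), if d = b then a - x else 0))"

text \<open>For \<open>d < b\<close>, bounces below \<open>2 * a - d\<close> come from
  \<open>x > d\<close> with \<open>s\<close> equal to \<open>2 * d\<close> or
  \<open>2 * d + 1\<close> by the parity of \<open>e - d\<close>; the others come from
  \<open>x = d\<close>.\<close>

definition decode :: "int \<Rightarrow> int \<Rightarrow> int \<times> int \<times> int \<Rightarrow> int \<times> int" where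
  "decode a b = (\<lambda>(d, e, p).
     if d = b then (a - p, e - 2 * p + b)
     else if e < 2 * a - d then (a - (e - d) div 2, 2 * d + (e - d) mod 2)
     else (d, e - 2 * a + 3 * d))"

lemma encode_simps:
  "x < b \<Longrightarrow> 2 * x \<le> s \<Longrightarrow> encode a b (x, s) = (x, 2 * a - 3 * x + s, 0)"
  "b \<le> x \<Longrightarrow> 2 * b \<le> s \<Longrightarrow> encode a b (x, s) = (b, 2 * (a - x) + s - b, a - x)"
  "r = 0 \<or> r = 1 \<Longrightarrow> i < x \<Longrightarrow> i < b \<Longrightarrow>
     encode a b (x, 2 * i + r) = (i, i + 2 * (a - x) + r, 0)"
proof -
  assume "x < b" "2 * x \<le> s"
  moreover from this have "x \<le> s div 2" by presburger
  ultimately show "encode a b (x, s) = (x, 2 * a - 3 * x + s, 0)"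
    by (simp add: encode_def bounce_code_def)
next
  assume "b \<le> x" "2 * b \<le> s"
  moreover from this have "b \<le> s div 2" by presburger
  ultimately show "encode a b (x, s) = (b, 2 * (a - x) + s - b, a - x)"
    by (simp add: encode_def bounce_code_def)
next
  assume r: "r = 0 \<or> r = 1" and "i < x" "i < b"
  moreover from r have "(2 * i + r) div 2 = i" "(2 * i + r + 1) div 2 = i + r"
    by presburger+
  moreover have "\<not> 2 * min x b \<le> 2 * i + r"
    using calculation by linarith
  ultimately show "encode a b (x, 2 * i + r) = (i, i + 2 * (a - x) + r, 0)"
    by (simp add: encode_def bounce_code_def)
qed

lemma decode_simps:
  "d \<noteq> b \<Longrightarrow> 2 * a - d \<le> e \<Longrightarrow> decode a b (d, e, p) = (d, e - 2 * a + 3 * d)"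
  "decode a b (b, e, p) = (a - p, e - 2 * p + b)"
  "r = 0 \<or> r = 1 \<Longrightarrow> d < x \<Longrightarrow> d \<noteq> b \<Longrightarrow>
     decode a b (d, d + 2 * (a - x) + r, p) = (x, 2 * d + r)"
proof -
  assume r: "r = 0 \<or> r = 1" and "d < x" "d \<noteq> b"
  moreover from r have "(2 * (a - x) + r) div 2 = a - x" "(2 * (a - x) + r) mod 2 = r"
    by presburger+
  moreover have "d + 2 * (a - x) + r < 2 * a - d"
    using calculation by linarith
  ultimately show "decode a b (d, d + 2 * (a - x) + r, p) = (x, 2 * d + r)"
    by (simp add: decode_def add.assoc)
qed (simp_all add: decode_def)

text \<open>The cases tell which of \<open>x\<close>, \<open>b\<close> and \<open>s div 2\<close> is
  the minimum \<open>d\<close>; the last counts only if strictly smallest, and \<open>r\<close> is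
  the parity of \<open>s\<close>.\<close>

lemma codes_cases:
  assumes "(x, s) \<in> codes a b"
  obtains "x < b" "2 * x \<le> s" | "b \<le> x" "2 * b \<le> s"
  | i r where "s = 2 * i + r" "r = 0 \<or> r = 1" "0 \<le> i" "i < x" "i < b"
proof -
  have "s = 2 * (s div 2) + s mod 2" "s mod 2 = 0 \<or> s mod 2 = 1" by presburger+
  moreover have "0 \<le> s div 2" using assms by (simp add: codes_def)
  moreover have "x < b \<and> 2 * x \<le> s \<or> b \<le> x \<and> 2 * b \<le> s \<or> s div 2 < x \<and> s div 2 < b"
    by presburger
  ultimately show thesis using that by metis
qed

lemma sym_codes_cases:
  assumes "(d, e, p) \<in> sym_codes a b"
  obtains "d < b" "2 * a - d \<le> e" | "d = b"
  | x r where "e = d + 2 * (a - x) + r" "r = 0 \<or> r = 1" "d < x" "x \<le> a" "d < b"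
proof -
  consider "d = b" | "d < b" "d \<le> e"
    using assms by (auto simp: sym_codes_def)
  then show thesis
  proof cases
    case 1
    then show ?thesis using that by blast
  next
    case 2
    \<comment> \<open>Solves \<open>e - d = 2 * (a - x) + r\<close>, where \<open>r\<close> is the
      parity of \<open>e - d\<close>.\<close>
    define x where "x = a - (e - d) div 2"
    have "e = d + 2 * (a - x) + (e - d) mod 2" "(e - d) mod 2 = 0 \<or> (e - d) mod 2 = 1"
      unfolding x_def by presburger+
    moreover have "x \<le> a" using 2 by (simp add: x_def)
    moreover have "2 * a - d \<le> e \<or> d < x" unfolding x_def by presburger
    ultimately show ?thesis using that 2 by metis
  qed
qed

lemma sum_codes_eq_sum_sym_codes:
  fixes q t :: "'a::comm_semiring_1"
  assumes "0 \<le> b"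
  shows "(\<Sum>c\<in>codes a b. q ^ nat (2 * fst c + b - snd c) * t ^ nat (bounce_code a b c)) =
    (\<Sum>(d, e, p)\<in>sym_codes a b. q ^ nat (2 * a + b - d - e) * t ^ nat e)"
proof (rule sum.reindex_bij_witness[where i = "decode a b" and j = "encode a b"], goal_cases)
  case (1 c)
  obtain x s where c: "c = (x, s)" by (cases c)
  from 1[unfolded c] show ?case unfolding c
    by (cases rule: codes_cases)
       (use 1 c in \<open>simp_all add: encode_simps decode_simps codes_def
          del: right_diff_distrib_numeral\<close>)
next
  case (2 c)
  obtain x s where c: "c = (x, s)" by (cases c)
  from 2[unfolded c] show ?case unfolding c
    by (cases rule: codes_cases)
       (use assms 2 c in \<open>auto simp: encode_simps sym_codes_def codes_def\<close>)
next
  case (3 c)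
  obtain d e p where c: "c = (d, e, p)" by (cases c)
  from 3[unfolded c] show ?case unfolding c
    by (cases rule: sym_codes_cases)
       (use 3 c in \<open>simp_all add: encode_simps decode_simps sym_codes_def
          del: right_diff_distrib_numeral\<close>)
next
  case (4 c)
  obtain d e p where c: "c = (d, e, p)" by (cases c)
  from 4[unfolded c] show ?case unfolding c
    by (cases rule: sym_codes_cases)
       (use assms 4 c in \<open>simp_all add: decode_simps del: right_diff_distrib_numeral\<close>,
        auto simp: sym_codes_def codes_def)
next
  case (5 c)
  obtain x s where c: "c = (x, s)" by (cases c)
  define d where "d = fst (encode a b c)"
  obtain p where enc: "encode a b c = (d, bounce_code a b c, p)"
    by (simp add: d_def c encode_def Let_def)
  \<comment> \<open>The area is the total degree \<open>2 * a + b - d\<close> less the bounce,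
    checked case by case.\<close>
  from 5[unfolded c] have eq: "2 * x + b - s = 2 * a + b - d - bounce_code a b c"
    by (cases rule: codes_cases) (use enc in \<open>auto simp: c encode_simps\<close>)
  then show ?case
    unfolding enc prod.case eq[symmetric] by (simp add: c)
qed

text \<open>For \<open>d < b\<close> the involution reflects the interval of \<open>e\<close>. For
  \<open>d = b\<close> it exchanges the conditions \<open>0 \<le> p\<close> and
  \<open>e \<le> a + p\<close> and preserves \<open>b + 2 * p \<le> e\<close>.\<close>

lemma sum_sym_codes_symmetric:
  fixes q t :: "'a::comm_semiring_1"
  shows "(\<Sum>(d, e, p)\<in>sym_codes a b. q ^ nat (2 * a + b - d - e) * t ^ nat e) =
    (\<Sum>(d, e, p)\<in>sym_codes a b. t ^ nat (2 * a + b - d - e) * q ^ nat e)"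
  by (rule sum.reindex_bij_witness
      [where i = "\<lambda>(d, e, p). (d, 2 * a + b - d - e, if d = b then p + a - e else 0)"
         and j = "\<lambda>(d, e, p). (d, 2 * a + b - d - e, if d = b then p + a - e else 0)"])
     (auto simp: sym_codes_def mult.commute)

lemma qt_catalan_vec_symmetric:
  assumes "length k = 3"
  shows "qt_catalan_vec k q t = qt_catalan_vec k t q"
  using sum_sym_codes_symmetric
  by (simp add: qt_catalan_vec_eq_sum_codes[OF assms] sum_codes_eq_sum_sym_codes)

theorem corollary2:
  fixes l :: "nat list"
  assumes "is_partition l" and "length l = 3"
  shows "qt_catalan l qvar tvar = qt_catalan l tvar qvar"
  unfolding qt_catalan_def by (rule sum.cong) (auto intro: qt_catalan_vec_symmetric)

end
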